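(* Let $G$ be a connected Eulerian partial $3$-tree with $n$ vertices. Then $\mathrm{cn}(G)\le \lfloor (n-1)/2\rfloor$.
   Context: All graphs are finite and simple. A graph is Eulerian if all of its vertices have even degree. A cycle decomposition of an Eulerian graph $G$ is a set of pairwise edge-disjoint cycles of $G$ that together cover $E(G)$; $\mathrm{cn}(G)$ is the minimum size of a cycle decomposition of $G$ (it is $0$ if $G$ has no edges). For a positive integer $k$, a graph $G$ is a $k$-tree if either $G\simeq K_k$, or $G$ contains a vertex $v$ such that the subgraph induced by the neighborhood $N(v)$ is isomorphic to $K_k$ and $G-v$ is a $k$-tree. A partial $k$-tree is a subgraph of a $k$-tree. (Partial $k$-trees are exactly the graphs with treewidth at most $k$.) *)

theory Defs
  imports Main
begin

text \<open>
  Finite simple undirected graphs, with edges as two-element sets of vertices.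
\<close>

record 'a ugraph =
  vertices :: "'a set"
  edges :: "'a set set"

definition simple_graph :: "'a ugraph \<Rightarrow> bool" where
  "simple_graph G \<longleftrightarrow>
     finite (vertices G) \<and> (\<forall>e\<in>edges G. e \<subseteq> vertices G \<and> card e = 2)"

definition degree :: "'a ugraph \<Rightarrow> 'a \<Rightarrow> nat" where
  "degree G v = card {e \<in> edges G. v \<in> e}"

definition neighborhood :: "'a ugraph \<Rightarrow> 'a \<Rightarrow> 'a set" where
  "neighborhood G v = {u \<in> vertices G. {u, v} \<in> edges G}"

definition eulerian :: "'a ugraph \<Rightarrow> bool" where
  "eulerian G \<longleftrightarrow> (\<forall>v\<in>vertices G. even (degree G v))"

text \<open>The graph without vertices is not regarded as connected.\<close>

definition connected_graph :: "'a ugraph \<Rightarrow> bool" where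
  "connected_graph G \<longleftrightarrow> vertices G \<noteq> {} \<and>
     (\<forall>u\<in>vertices G. \<forall>v\<in>vertices G. (u, v) \<in> {(x, y). {x, y} \<in> edges G}\<^sup>*)"

definition induced_subgraph :: "'a ugraph \<Rightarrow> 'a set \<Rightarrow> 'a ugraph" where
  "induced_subgraph G W =
     \<lparr>vertices = vertices G \<inter> W, edges = {e \<in> edges G. e \<subseteq> W}\<rparr>"

definition delete_vertex :: "'a ugraph \<Rightarrow> 'a \<Rightarrow> 'a ugraph" where
  "delete_vertex G v = induced_subgraph G (vertices G - {v})"

definition subgraph :: "'a ugraph \<Rightarrow> 'a ugraph \<Rightarrow> bool" where
  "subgraph H G \<longleftrightarrow>
     simple_graph H \<and> vertices H \<subseteq> vertices G \<and> edges H \<subseteq> edges G"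

definition graph_iso :: "'a ugraph \<Rightarrow> 'b ugraph \<Rightarrow> bool" where
  "graph_iso G H \<longleftrightarrow> (\<exists>f. bij_betw f (vertices G) (vertices H) \<and>
     (\<forall>u\<in>vertices G. \<forall>v\<in>vertices G. {u, v} \<in> edges G \<longleftrightarrow> {f u, f v} \<in> edges H))"

definition complete_graph :: "nat \<Rightarrow> nat ugraph" where
  "complete_graph k =
     \<lparr>vertices = {..<k}, edges = {{i, j} | i j. i < k \<and> j < k \<and> i \<noteq> j}\<rparr>"

inductive ktree :: "nat \<Rightarrow> 'a ugraph \<Rightarrow> bool" for k :: nat where
  base: "simple_graph G \<Longrightarrow> graph_iso G (complete_graph k) \<Longrightarrow> ktree k G"
| step: "simple_graph G \<Longrightarrow> v \<in> vertices G \<Longrightarrow>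
         graph_iso (induced_subgraph G (neighborhood G v)) (complete_graph k) \<Longrightarrow>
         ktree k (delete_vertex G v) \<Longrightarrow> ktree k G"

text \<open>
  Subgraphs are taken up to isomorphism, and the host \<open>k\<close>-tree lives on natural numbers: a
  \<open>k\<close>-tree has at least \<open>k\<close> vertices, which the vertex type of \<open>G\<close> might not provide.
\<close>

definition partial_ktree :: "nat \<Rightarrow> 'a ugraph \<Rightarrow> bool" where
  "partial_ktree k G \<longleftrightarrow>
     (\<exists>(T :: nat ugraph) H. ktree k T \<and> subgraph H T \<and> graph_iso G H)"

text \<open>A cycle has no isolated vertices, so it is represented by its set of edges.\<close>

definition is_cycle :: "'a set set \<Rightarrow> bool" where
  "is_cycle C \<longleftrightarrow> (\<exists>vs. 3 \<le> length vs \<and> distinct vs \<and>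
     C = {{vs ! i, vs ! (Suc i mod length vs)} | i. i < length vs})"

definition cycle_decomposition :: "'a ugraph \<Rightarrow> 'a set set set \<Rightarrow> bool" where
  "cycle_decomposition G D \<longleftrightarrow>
     (\<forall>C\<in>D. is_cycle C) \<and> pairwise disjnt D \<and> \<Union>D = edges G"

text \<open>Only meaningful for Eulerian graphs: these are the graphs with a cycle decomposition.\<close>

definition cn :: "'a ugraph \<Rightarrow> nat" where
  "cn G = (LEAST m. \<exists>D. cycle_decomposition G D \<and> card D = m)"

end

(* Every nonempty set of edges of a 3-tree has two vertices of degree at most 3, which have degree
   exactly 2 if all degrees are even. Induct on the number of edges. If the edge set splits into two
   nonempty parts with at most one common vertex, both parts are again Eulerian and the bounds add
   up. Otherwise the graph is 2-connected, so some cycle passes through both vertices of degree 2,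
   and removing it isolates these two vertices. The bound counts only non-isolated vertices, so that
   it also applies to a disconnected remainder. *)
theory Submission
  imports Defs
begin

section \<open>Degrees, parity and separability of edge sets\<close>

definition edeg :: "'a set set \<Rightarrow> 'a \<Rightarrow> nat" where
  "edeg E v = card {e \<in> E. v \<in> e}"

text \<open>For a nonempty set of two-element edges the negation says that the edges form one block:
  a connected graph without a cut vertex. Edge sets have no isolated vertices, so the vertices are
  recovered as the union.\<close>

definition separable :: "'a set set \<Rightarrow> bool" where
  "separable E \<longleftrightarrow> (\<exists>A B. E = A \<union> B \<and> A \<inter> B = {} \<and> A \<noteq> {} \<and> B \<noteq> {} \<and> card (\<Union>A \<inter> \<Union>B) \<le> 1)"

definition avoiding :: "'a set set \<Rightarrow> 'a \<Rightarrow> ('a \<times> 'a) set" where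
  "avoiding E x = {(p, q). {p, q} \<in> E \<and> p \<noteq> x \<and> q \<noteq> x}"

definition upath :: "'a set set \<Rightarrow> 'a list \<Rightarrow> bool" where
  "upath E p \<longleftrightarrow> p \<noteq> [] \<and> distinct p \<and> successively (\<lambda>x y. {x, y} \<in> E) p"

definition cycle_edges :: "'a list \<Rightarrow> 'a set set" where
  "cycle_edges vs = {{vs ! i, vs ! (Suc i mod length vs)} | i. i < length vs}"

lemma edeg_pos_iff:
  assumes "finite E"
  shows "edeg E v > 0 \<longleftrightarrow> v \<in> \<Union>E"
  using assms by (auto simp: edeg_def card_gt_0_iff)

lemma edeg_eq_0: "v \<notin> \<Union>E \<Longrightarrow> edeg E v = 0"
proof -
  assume "v \<notin> \<Union>E"
  then have "{e \<in> E. v \<in> e} = {}" by blast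
  then show ?thesis unfolding edeg_def by (simp only: card.empty)
qed

lemma edeg_Un_disjoint:
  assumes "finite A" "finite B" "A \<inter> B = {}"
  shows "edeg (A \<union> B) v = edeg A v + edeg B v"
proof -
  have "{e \<in> A \<union> B. v \<in> e} = {e \<in> A. v \<in> e} \<union> {e \<in> B. v \<in> e}" by auto
  moreover have "{e \<in> A. v \<in> e} \<inter> {e \<in> B. v \<in> e} = {}" using assms by auto
  ultimately show ?thesis using assms by (simp add: edeg_def card_Un_disjoint)
qed

lemma finite_Union_edges:
  assumes "finite E" "\<And>e. e \<in> E \<Longrightarrow> card e = 2"
  shows "finite (\<Union>E)"
  using assms by (intro finite_Union) (auto intro!: card_ge_0_finite)

lemma sum_edeg:
  assumes "finite E" and two: "\<And>e. e \<in> E \<Longrightarrow> card e = 2"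
  shows "(\<Sum>v\<in>\<Union>E. edeg E v) = 2 * card E"
proof -
  have fin: "finite (\<Union>E)" by (rule finite_Union_edges[OF assms])
  have "{v \<in> \<Union>E. v \<in> e} = e" if "e \<in> E" for e using that by auto
  then have "\<forall>e\<in>E. card {v \<in> \<Union>E. v \<in> e} = 2" using two by simp
  from sum_multicount[OF fin assms(1) this] show ?thesis by (simp add: edeg_def)
qed

text \<open>The degrees sum to twice the number of edges, so the parity at one vertex is forced by
  the parities at all the others.\<close>

lemma even_edeg_all_but_one:
  assumes "finite E" "\<And>e. e \<in> E \<Longrightarrow> card e = 2"
    and ev: "\<And>v. v \<noteq> x \<Longrightarrow> even (edeg E v)"
  shows "even (edeg E v)"
proof (cases "v = x \<and> x \<in> \<Union>E")
  case True
  have fin: "finite (\<Union>E)" by (rule finite_Union_edges[OF assms(1,2)])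
  have "edeg E x + (\<Sum>v\<in>\<Union>E - {x}. edeg E v) = 2 * card E"
    using sum_edeg[OF assms(1,2)] sum.remove[OF fin, of x "edeg E"] True by simp
  moreover have "even (\<Sum>v\<in>\<Union>E - {x}. edeg E v)"
    by (intro dvd_sum) (auto intro: ev)
  ultimately show ?thesis using True
    by (metis even_add even_mult_iff even_numeral)
next
  case False
  then show ?thesis using ev edeg_pos_iff[OF assms(1), of v] by (cases "v = x") auto
qed

text \<open>A vertex that lies in only one part has either none or all of its edges in
  \<open>A\<close>, so its degree in \<open>A\<close> is even. The single possible common vertex is
  then settled by the parity of the degree sum. Finiteness of \<open>\<Union>A\<close> matters
  because \<open>card\<close> is 0 on infinite sets.\<close>

lemma even_edeg_block:
  assumes "finite A" "finite B" "A \<inter> B = {}" "\<And>e. e \<in> A \<Longrightarrow> card e = 2"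
    and "finite (\<Union>A)" "card (\<Union>A \<inter> \<Union>B) \<le> 1"
    and ev: "\<And>v. even (edeg (A \<union> B) v)"
  shows "even (edeg A v)"
proof -
  obtain x where x: "\<Union>A \<inter> \<Union>B \<subseteq> {x}"
  proof (cases "\<Union>A \<inter> \<Union>B = {}")
    case False
    then have "card (\<Union>A \<inter> \<Union>B) = 1"
      using assms(5,6) by (metis card_0_eq finite_Int le_neq_implies_less less_one)
    then show ?thesis using that by (metis card_1_singletonE subset_refl)
  qed (use that in blast)
  show ?thesis
  proof (rule even_edeg_all_but_one[OF assms(1,4)])
    fix v assume "v \<noteq> x"
    then have "edeg A v = 0 \<or> edeg B v = 0"
      using x edeg_pos_iff[OF assms(1)] edeg_pos_iff[OF assms(2)] by blast
    then show "even (edeg A v)"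
      using ev[of v] edeg_Un_disjoint[OF assms(1-3), of v] by auto
  qed
qed

section \<open>Paths and cycles in edge sets without cut vertices\<close>

text \<open>Let \<open>R\<close> be what \<open>y\<close> reaches without using \<open>x\<close>.
  The edges meeting \<open>R\<close> and the remaining edges can share no vertex but
  \<open>x\<close>, so if \<open>z\<close> were outside \<open>R\<close>, this partition would
  separate \<open>E\<close>.\<close>

lemma avoiding_connected:
  assumes two: "\<And>e. e \<in> E \<Longrightarrow> card e = 2" and ns: "\<not> separable E"
    and y: "y \<in> \<Union>E" "y \<noteq> x" and z: "z \<in> \<Union>E" "z \<noteq> x"
  shows "(y, z) \<in> (avoiding E x)\<^sup>*"
proof (rule ccontr)
  assume neg: "(y, z) \<notin> (avoiding E x)\<^sup>*"
  define R where "R = {w. (y, w) \<in> (avoiding E x)\<^sup>*}"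
  have xR: "w \<noteq> x" if "w \<in> R" for w
  proof -
    have "(y, w) \<in> (avoiding E x)\<^sup>*" using that by (simp add: R_def)
    then show ?thesis using y(2) by (induction rule: rtrancl_induct) (auto simp: avoiding_def)
  qed
  have step: "q \<in> R" if "p \<in> R" "{p, q} \<in> E" "q \<noteq> x" for p q
    using that xR[of p] unfolding R_def
    by (auto intro: rtrancl_into_rtrancl simp: avoiding_def)
  have other: "\<exists>q. e = {p, q}" if e: "e \<in> E" "p \<in> e" for e p
    using two[OF e(1)] e(2) by (auto simp: card_2_iff insert_commute)
  define A where "A = {e \<in> E. e \<inter> R \<noteq> {}}"
  have "y \<in> R" by (simp add: R_def)
  then have "A \<noteq> {}" using y by (auto simp: A_def)
  moreover have "E - A \<noteq> {}"
  proof -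
    obtain f where f: "f \<in> E" "z \<in> f" using z by blast
    have "z \<notin> R" using neg by (simp add: R_def)
    have "f \<inter> R = {}"
    proof (rule ccontr)
      assume "f \<inter> R \<noteq> {}"
      then obtain w where w: "w \<in> f" "w \<in> R" by blast
      obtain q where "f = {w, q}" using other[OF f(1) w(1)] by blast
      moreover have "z \<noteq> w" using w \<open>z \<notin> R\<close> by blast
      ultimately have "{w, z} \<in> E" using f by auto
      then show False using step[OF w(2)] z \<open>z \<notin> R\<close> by blast
    qed
    then show ?thesis using f by (auto simp: A_def)
  qed
  moreover have "\<Union>A \<inter> \<Union>(E - A) \<subseteq> {x}"
  proof
    fix w assume w: "w \<in> \<Union>A \<inter> \<Union>(E - A)"
    then obtain e p where e: "e \<in> E" "w \<in> e" "p \<in> e" "p \<in> R" by (auto simp: A_def)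
    have "w \<notin> R" using w by (auto simp: A_def)
    obtain q where "e = {p, q}" using other[OF e(1,3)] by blast
    then have "{p, w} \<in> E" using e \<open>w \<notin> R\<close> by auto
    then show "w \<in> {x}" using step[OF e(4)] \<open>w \<notin> R\<close> by blast
  qed
  then have "card (\<Union>A \<inter> \<Union>(E - A)) \<le> 1"
    using card_mono[of "{x}"] by simp
  moreover have "E = A \<union> (E - A)" "A \<inter> (E - A) = {}" by (auto simp: A_def)
  ultimately show False using ns unfolding separable_def by blast
qed

text \<open>Turns a walk into a path: a vertex is prepended, and if the path already contains it,
  only the tail from there on is kept. The endpoint must differ from \<open>x\<close> because the
  closure also contains the reflexive pair at \<open>x\<close>.\<close>

lemma upath_if_rtrancl_avoiding:
  assumes "(y, z) \<in> (avoiding E x)\<^sup>*" "z \<noteq> x"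
  shows "\<exists>p. upath E p \<and> hd p = y \<and> last p = z \<and> x \<notin> set p"
  using assms(1)
proof (induction rule: converse_rtrancl_induct)
  case base
  then show ?case using assms(2) by (intro exI[of _ "[z]"]) (auto simp: upath_def)
next
  case (step y w)
  then obtain p where p: "upath E p" "hd p = w" "last p = z" "x \<notin> set p" by blast
  show ?case
  proof (cases "y \<in> set p")
    case True
    then obtain p1 p2 where "p = p1 @ y # p2" by (meson split_list)
    then show ?thesis using p
      by (intro exI[of _ "y # p2"]) (auto simp: upath_def successively_append_iff)
  next
    case False
    then show ?thesis using p step(1)
      by (intro exI[of _ "y # p"]) (auto simp: upath_def avoiding_def successively_Cons)
  qed
qed

lemma cycle_edges_subset:
  assumes "upath E p" "{last p, hd p} \<in> E"
  shows "cycle_edges p \<subseteq> E"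
proof
  fix e assume "e \<in> cycle_edges p"
  then obtain i where i: "i < length p" "e = {p ! i, p ! (Suc i mod length p)}"
    by (auto simp: cycle_edges_def)
  show "e \<in> E"
  proof (cases "Suc i < length p")
    case True
    then show ?thesis using i assms(1) by (simp add: upath_def successively_conv_nth)
  next
    case False
    then have "Suc i = length p" using i by simp
    then have "p ! i = last p" "p ! (Suc i mod length p) = hd p"
      using i assms(1) by (auto simp: upath_def last_conv_nth hd_conv_nth
        simp flip: \<open>Suc i = length p\<close>)
    then show ?thesis using i assms(2) by simp
  qed
qed

lemma edeg_cycle_edges:
  assumes "distinct vs" "3 \<le> length vs"
  shows "edeg (cycle_edges vs) v = (if v \<in> set vs then 2 else 0)"
proof (cases "v \<in> set vs")
  case False
  have "vs ! (Suc i mod length vs) \<in> set vs" for i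
    using assms(2) by (intro nth_mem mod_less_divisor) linarith
  then have "v \<notin> \<Union>(cycle_edges vs)" using False by (auto simp: cycle_edges_def)
  then show ?thesis using False by (simp add: edeg_eq_0)
next
  case True
  let ?n = "length vs"
  let ?s = "\<lambda>i. Suc i mod ?n"
  obtain j where j: "j < ?n" "v = vs ! j" using True by (auto simp: in_set_conv_nth)
  \<comment> \<open>\<open>l\<close> is the cyclic predecessor of \<open>j\<close>. With length at
    least 3 it differs from the cyclic successor, so \<open>v\<close> has two distinct
    edges.\<close>
  define l where "l = (if j = 0 then ?n - 1 else j - 1)"
  have l: "l < ?n" "?s l = j" "l \<noteq> j" "?s j \<noteq> l"
    using j(1) assms(2) by (auto simp: l_def mod_Suc)
  have sl: "i = l" if "i < ?n" "?s i = j" for i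
    using that j(1) by (auto simp: l_def mod_Suc split: if_splits)
  have lt: "?s i < ?n" for i using assms(2) by (intro mod_less_divisor) linarith
  have sj: "?s j \<noteq> j" using j(1) assms(2) by (auto simp: mod_Suc)
  have inj: "vs ! a = vs ! b \<longleftrightarrow> a = b" if "a < ?n" "b < ?n" for a b
    using that assms(1) by (simp add: nth_eq_iff_index_eq)
  have "{e \<in> cycle_edges vs. v \<in> e} = {{vs ! j, vs ! ?s j}, {vs ! l, vs ! j}}"
  proof
    show "{e \<in> cycle_edges vs. v \<in> e} \<subseteq> {{vs ! j, vs ! ?s j}, {vs ! l, vs ! j}}"
    proof
      fix e assume "e \<in> {e \<in> cycle_edges vs. v \<in> e}"
      then obtain i where i: "i < ?n" "e = {vs ! i, vs ! ?s i}" "v = vs ! i \<or> v = vs ! ?s i"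
        by (auto simp: cycle_edges_def)
      have "i = j \<or> ?s i = j" using i j inj lt by metis
      then show "e \<in> {{vs ! j, vs ! ?s j}, {vs ! l, vs ! j}}" using i sl by fastforce
    qed
    show "{{vs ! j, vs ! ?s j}, {vs ! l, vs ! j}} \<subseteq> {e \<in> cycle_edges vs. v \<in> e}"
      using j l by (auto simp: cycle_edges_def)
  qed
  moreover have "{vs ! j, vs ! ?s j} \<noteq> {vs ! l, vs ! j}"
    using inj[of j l] inj[of "?s j" l] inj[of "?s j" j] lt j l sj by (auto simp: doubleton_eq_iff)
  ultimately show ?thesis using True by (simp add: edeg_def)
qed

text \<open>This is a case of the fact that any two vertices of a 2-connected graph lie on a common
  cycle. As \<open>u\<close> has exactly two neighbours \<open>a\<close> and \<open>b\<close>, the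
  cycles through \<open>u\<close> arise by closing up the paths from \<open>a\<close> to
  \<open>b\<close> that avoid \<open>u\<close>. It remains to find such a path through
  \<open>v\<close>; the set \<open>S\<close> collects the vertices that such paths reach.\<close>

lemma cycle_through_degree_two_vertex:
  assumes two: "\<And>e. e \<in> E \<Longrightarrow> card e = 2" and ns: "\<not> separable E"
    and u: "edeg E u = 2" and v: "v \<in> \<Union>E" "v \<noteq> u"
  shows "\<exists>vs. 3 \<le> length vs \<and> distinct vs \<and> u \<in> set vs \<and> v \<in> set vs \<and> cycle_edges vs \<subseteq> E"
proof -
  obtain e f where ef: "{e \<in> E. u \<in> e} = {e, f}" "e \<noteq> f"
    using u by (auto simp: edeg_def card_2_iff)
  have "\<exists>w. g = {u, w} \<and> w \<noteq> u" if "g \<in> {e, f}" for g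
  proof -
    have "g \<in> E" "u \<in> g" using that ef by blast+
    then show ?thesis using two[of g] by (auto simp: card_2_iff)
  qed
  from this[of e] this[of f] obtain a b
    where ab: "e = {u, a}" "f = {u, b}" "a \<noteq> u" "b \<noteq> u" by auto
  have "a \<noteq> b" using ef(2) ab by blast
  have "e \<in> E" "f \<in> E" using ef(1) by blast+
  then have E: "{u, a} \<in> E" "{u, b} \<in> E" using ab(1,2) by simp_all
  have nb: "w = a \<or> w = b" if "{u, w} \<in> E" for w
  proof -
    have "{u, w} \<in> {e \<in> E. u \<in> e}" using that by simp
    then have "{u, w} \<in> {e, f}" by (simp only: ef(1))
    then show ?thesis using ab by (auto simp: doubleton_eq_iff)
  qed
  define ab_path where "ab_path p \<longleftrightarrow> upath E p \<and> hd p = a \<and> last p = b \<and> u \<notin> set p" for p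
  define S where "S = {w. \<exists>p. ab_path p \<and> w \<in> set p}"
  have "v \<in> S"
  proof (rule ccontr)
    assume "v \<notin> S"
    \<comment> \<open>Some edge \<open>xy\<close> leaves \<open>S\<close>; it extends to an ear attached to a path through \<open>x\<close>,
      and rerouting that path along the ear puts \<open>y\<close> into \<open>S\<close>.\<close>
    have "(a, b) \<in> (avoiding E u)\<^sup>*"
      using avoiding_connected[OF two ns] E ab by blast
    then obtain p0 where "ab_path p0"
      using upath_if_rtrancl_avoiding ab(4) unfolding ab_path_def by metis
    then have "a \<in> S" unfolding S_def ab_path_def upath_def using hd_in_set by blast
    have "(a, v) \<in> (avoiding E u)\<^sup>*"
      using avoiding_connected[OF two ns] E ab v by blast
    then have "\<exists>x y. x \<in> S \<and> y \<notin> S \<and> (x, y) \<in> avoiding E u"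
      using \<open>a \<in> S\<close> \<open>v \<notin> S\<close> by (induction rule: rtrancl_induct) blast+
    then obtain x y where xy: "x \<in> S" "y \<notin> S" "{x, y} \<in> E" "x \<noteq> u" "y \<noteq> u"
      by (auto simp: avoiding_def)
    obtain p where p: "ab_path p" "x \<in> set p" using xy(1) by (auto simp: S_def)
    have yp: "y \<notin> set p" using xy(2) p by (auto simp: S_def)
    have abp: "a \<in> set p" "b \<in> set p" using p by (auto simp: ab_path_def upath_def)
    \<comment> \<open>The ear is taken from a path that leads from \<open>y\<close> to
      \<open>u\<close> and avoids \<open>x\<close>; this ensures that it meets \<open>p\<close> at a
      vertex other than \<open>x\<close>.\<close>
    have "(y, u) \<in> (avoiding E x)\<^sup>*"
    proof (rule avoiding_connected[OF two ns])
      show "y \<in> \<Union>E" "u \<in> \<Union>E" using xy(3) E(1) by blast+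
      show "y \<noteq> x" "u \<noteq> x" using yp p(2) xy(4) by blast+
    qed
    then obtain q where q: "upath E q" "hd q = y" "last q = u" "x \<notin> set q"
      using upath_if_rtrancl_avoiding xy(4) by (metis (no_types, lifting))
    \<comment> \<open>The path \<open>q\<close> is cut at its first vertex \<open>z\<close> on
      \<open>p\<close> or equal to \<open>u\<close>; one exists because \<open>q\<close> ends in
      \<open>u\<close>.\<close>
    have "\<exists>w\<in>set q. w \<in> insert u (set p)" using q by (intro bexI[of _ "last q"]) (auto simp: upath_def)
    from split_list_first_prop[OF this] obtain q1 z q2 where q12: "q = q1 @ z # q2"
      "z \<in> insert u (set p)" "\<forall>w\<in>set q1. w \<notin> insert u (set p)" by blast
    have "q1 \<noteq> []" using q(2) q12 yp xy(5) by auto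
    then have q1: "hd q1 = y" "{last q1, z} \<in> E" "distinct q1"
      "successively (\<lambda>x y. {x, y} \<in> E) q1" "last q1 \<in> set q1"
      using q q12 by (auto simp: upath_def successively_append_iff)
    \<comment> \<open>The vertex \<open>u\<close> can only be entered from \<open>a\<close> or
      \<open>b\<close>, and both lie on \<open>p\<close>, so \<open>q\<close> meets \<open>p\<close>
      before it reaches \<open>u\<close>.\<close>
    have "z \<noteq> u"
    proof
      assume "z = u"
      then have "last q1 \<in> {a, b}" using q1(2) nb by (auto simp: insert_commute)
      then show False using q1(5) q12(3) abp by blast
    qed
    then have zp: "z \<in> set p" using q12 by blast
    have zx: "z \<noteq> x" using q q12 by auto
    obtain p1 p2 where p12: "p = p1 @ x # p2" using p(2) by (meson split_list)
    have "(\<lambda>x y. {y, x} \<in> E) = (\<lambda>x y. {x, y} \<in> E)" by (simp add: insert_commute)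
    then have rev_q1: "successively (\<lambda>x y. {x, y} \<in> E) (rev q1)" "{z, last q1} \<in> E" "{y, x} \<in> E"
      using q1(2,4) xy(3) by (simp_all add: insert_commute)
    have disj: "set q1 \<inter> set p = {}" "u \<notin> set q1" using q12 by auto
    have yq: "y \<in> set q1" using q1(1) \<open>q1 \<noteq> []\<close> by auto
    \<comment> \<open>The segment of \<open>p\<close> between \<open>x\<close> and \<open>z\<close>
      is replaced by the ear. If \<open>z\<close> comes before \<open>x\<close> on \<open>p\<close>,
      the ear is traversed backwards.\<close>
    have "\<exists>r. ab_path r \<and> y \<in> set r"
    proof (cases "z \<in> set p2")
      case True
      then obtain p3 p4 where "p2 = p3 @ z # p4" by (meson split_list)
      then have pp: "p = p1 @ x # p3 @ z # p4" using p12 by simp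
      have "ab_path (p1 @ x # q1 @ z # p4)"
        using p(1) disj q1 xy(3) \<open>q1 \<noteq> []\<close> unfolding ab_path_def upath_def pp
        by (auto simp: successively_append_iff successively_Cons hd_append)
      then show ?thesis using yq by (intro exI[of _ "p1 @ x # q1 @ z # p4"]) simp
    next
      case False
      then have "z \<in> set p1" using zp zx p12 by auto
      then obtain p3 p4 where "p1 = p3 @ z # p4" by (meson split_list)
      then have pp: "p = p3 @ z # p4 @ x # p2" using p12 by simp
      have "ab_path (p3 @ z # rev q1 @ x # p2)"
        using p(1) disj rev_q1 q1(1,3) \<open>q1 \<noteq> []\<close> unfolding ab_path_def upath_def pp
        by (auto simp: successively_append_iff successively_Cons hd_append hd_rev last_rev
            simp del: successively_rev)
      then show ?thesis using yq by (intro exI[of _ "p3 @ z # rev q1 @ x # p2"]) simp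
    qed
    then show False using xy(2) by (auto simp: S_def)
  qed
  then obtain p where p: "ab_path p" "v \<in> set p" by (auto simp: S_def)
  have up: "upath E (u # p)"
    using p(1) E by (auto simp: ab_path_def upath_def successively_Cons)
  have "cycle_edges (u # p) \<subseteq> E"
    using cycle_edges_subset[OF up] p(1) E by (auto simp: ab_path_def upath_def insert_commute)
  moreover have "3 \<le> length (u # p)"
  proof -
    have "{a, b} \<subseteq> set p" using p(1) by (auto simp: ab_path_def upath_def)
    then have "card {a, b} \<le> length p" by (meson card_length card_mono finite_set le_trans)
    then show ?thesis using \<open>a \<noteq> b\<close> by simp
  qed
  moreover have "distinct (u # p)" using up by (simp add: upath_def)
  ultimately show ?thesis using p(2) by (intro exI[of _ "u # p"]) simp
qed

section \<open>The bound for Eulerian edge sets\<close>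

text \<open>This is what the induction uses of 3-trees. Quantifying over all subsets lets it pass to
  smaller edge sets. The threshold is 3 because a subset may have odd degrees.\<close>

definition two_sparse :: "'a set set \<Rightarrow> bool" where
  "two_sparse E \<longleftrightarrow> (\<forall>F. F \<subseteq> E \<and> F \<noteq> {} \<longrightarrow>
     (\<exists>u v. u \<noteq> v \<and> u \<in> \<Union>F \<and> v \<in> \<Union>F \<and> edeg F u \<le> 3 \<and> edeg F v \<le> 3))"

lemma Union_cycle_families:
  assumes "finite D1" "\<forall>C\<in>D1. is_cycle C" "pairwise disjnt D1" "\<Union>D1 = A"
    and "finite D2" "\<forall>C\<in>D2. is_cycle C" "pairwise disjnt D2" "\<Union>D2 = B"
    and "A \<inter> B = {}"
  shows "finite (D1 \<union> D2)" "\<forall>C\<in>D1 \<union> D2. is_cycle C" "pairwise disjnt (D1 \<union> D2)"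
    "\<Union>(D1 \<union> D2) = A \<union> B"
proof -
  have "disjnt X Y \<and> disjnt Y X" if "X \<in> D1" "Y \<in> D2" for X Y
  proof -
    have "X \<subseteq> A" "Y \<subseteq> B" using that assms(4,8) by blast+
    then show ?thesis using assms(9) by (auto simp: disjnt_def)
  qed
  then show "pairwise disjnt (D1 \<union> D2)"
    using assms(3,7) unfolding pairwise_def by (metis Un_iff)
  show "\<forall>C\<in>D1 \<union> D2. is_cycle C" using assms(2,6) by blast
qed (use assms in simp_all)

text \<open>The bound is stated without subtraction or division so that bounds for two parts can be
  added. It fails for the empty edge set, which has no vertices, so an empty remainder is treated
  separately.\<close>

lemma cycle_decomposition_bound:
  assumes "finite E" "\<And>e. e \<in> E \<Longrightarrow> card e = 2" "\<And>v. even (edeg E v)" "two_sparse E" "E \<noteq> {}"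
  shows "\<exists>D. finite D \<and> (\<forall>C\<in>D. is_cycle C) \<and> pairwise disjnt D \<and> \<Union>D = E \<and>
    2 * card D + 1 \<le> card (\<Union>E)"
  using assms
proof (induction "card E" arbitrary: E rule: less_induct)
  case less
  note fin = less.prems(1) and two = less.prems(2) and ev = less.prems(3)
    and sparse = less.prems(4)
  have finU: "finite (\<Union>E)" by (rule finite_Union_edges[OF fin two])
  have IH: "\<exists>D. finite D \<and> (\<forall>C\<in>D. is_cycle C) \<and> pairwise disjnt D \<and> \<Union>D = F \<and>
      2 * card D + 1 \<le> card (\<Union>F)" if "F \<subset> E" "F \<noteq> {}" "\<And>v. even (edeg F v)" for F
  proof (rule less.hyps)
    show "card F < card E" using that(1) fin by (simp add: psubset_card_mono)
    show "finite F" using that(1) fin by (meson finite_subset psubset_imp_subset)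
    show "card e = 2" if "e \<in> F" for e using that \<open>F \<subset> E\<close> two by blast
    show "two_sparse F" using sparse that(1) unfolding two_sparse_def by (meson order_trans psubset_imp_subset)
  qed (use that in auto)
  show ?case
  proof (cases "separable E")
    case True
    then obtain A B where AB: "E = A \<union> B" "A \<inter> B = {}" "A \<noteq> {}" "B \<noteq> {}" "card (\<Union>A \<inter> \<Union>B) \<le> 1"
      by (auto simp: separable_def)
    have finAB: "finite A" "finite B" "finite (\<Union>A)" "finite (\<Union>B)" using fin finU AB(1) by auto
    have sub: "A \<subset> E" "B \<subset> E" using AB(1-4) by blast+
    have "\<And>v. even (edeg A v)" "\<And>v. even (edeg B v)"
    proof -
      show "even (edeg A v)" for v
        using AB(2,5) finAB two ev unfolding AB(1) by (intro even_edeg_block[of A B]) auto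
      show "even (edeg B v)" for v
        using AB(2,5) finAB two ev unfolding AB(1)
        by (intro even_edeg_block[of B A]) (auto simp: Un_commute Int_commute)
    qed
    note IH[OF sub(1) AB(3) this(1)] IH[OF sub(2) AB(4) this(2)]
    then obtain D1 D2
      where D1: "finite D1" "\<forall>C\<in>D1. is_cycle C" "pairwise disjnt D1" "\<Union>D1 = A"
        "2 * card D1 + 1 \<le> card (\<Union>A)"
      and D2: "finite D2" "\<forall>C\<in>D2. is_cycle C" "pairwise disjnt D2" "\<Union>D2 = B"
        "2 * card D2 + 1 \<le> card (\<Union>B)"
      by (elim exE conjE) rule
    \<comment> \<open>The two summands 1 from the parts add up to 2; the surplus absorbs the at most
      one vertex that is counted twice.\<close>
    have "card (\<Union>A) + card (\<Union>B) = card (\<Union>E) + card (\<Union>A \<inter> \<Union>B)"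
      using card_Un_Int[OF finAB(3,4)] AB(1) by simp
    moreover have "card (D1 \<union> D2) \<le> card D1 + card D2" by (rule card_Un_le)
    ultimately have "2 * card (D1 \<union> D2) + 1 \<le> card (\<Union>E)"
      using D1(5) D2(5) AB(5) by linarith
    with Union_cycle_families[OF D1(1-4) D2(1-4) AB(2)] AB(1) show ?thesis
      by (intro exI[of _ "D1 \<union> D2"]) simp
  next
    case False
    obtain u v where uv: "u \<noteq> v" "u \<in> \<Union>E" "v \<in> \<Union>E" "edeg E u \<le> 3" "edeg E v \<le> 3"
      using sparse less.prems(5) unfolding two_sparse_def by blast
    \<comment> \<open>A degree that is positive, even and at most 3 equals 2.\<close>
    have deg2: "edeg E w = 2" if "w \<in> \<Union>E" "edeg E w \<le> 3" for w
    proof -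
      have "edeg E w > 0" using that edeg_pos_iff[OF fin] by blast
      moreover have "edeg E w \<noteq> 1" "edeg E w \<noteq> 3" using ev[of w] by auto
      ultimately show ?thesis using that by linarith
    qed
    obtain vs where vs: "3 \<le> length vs" "distinct vs" "u \<in> set vs" "v \<in> set vs"
      "cycle_edges vs \<subseteq> E"
      using cycle_through_degree_two_vertex[OF two False deg2[OF uv(2,4)] uv(3)] uv(1) by metis
    let ?C = "cycle_edges vs"
    have finC: "finite ?C" using vs(5) fin finite_subset by blast
    have cyc: "is_cycle ?C" unfolding is_cycle_def cycle_edges_def using vs by blast
    have deg: "edeg E w = edeg ?C w + edeg (E - ?C) w" for w
      using edeg_Un_disjoint[of ?C "E - ?C" w] finC fin vs(5) by (simp add: Un_absorb1)
    have degC: "edeg ?C w = (if w \<in> set vs then 2 else 0)" for w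
      by (rule edeg_cycle_edges[OF vs(2,1)])
    have UC: "\<Union>?C = set vs"
    proof (rule set_eqI)
      show "w \<in> \<Union>?C \<longleftrightarrow> w \<in> set vs" for w
        unfolding edeg_pos_iff[OF finC, symmetric] degC by simp
    qed
    show ?thesis
    proof (cases "E - ?C = {}")
      case True
      \<comment> \<open>A single cycle needs \<open>2 * 1 + 1\<close> vertices, and every cycle has
        at least three.\<close>
      then have "?C = E" using vs(5) by blast
      moreover have "card (set vs) \<ge> 3" using vs by (simp add: distinct_card)
      ultimately show ?thesis using cyc UC by (intro exI[of _ "{?C}"]) auto
    next
      case ne: False
      have "?C \<noteq> {}" using UC vs(3) by auto
      then have sub: "E - ?C \<subset> E" using vs(5) by blast
      have "even (edeg (E - ?C) w)" for w
        using ev[of w] deg[of w] degC[of w] by (auto split: if_splits)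
      from IH[OF sub ne this] obtain D where D: "finite D" "\<forall>C\<in>D. is_cycle C"
        "pairwise disjnt D" "\<Union>D = E - ?C" "2 * card D + 1 \<le> card (\<Union>(E - ?C))"
        by (elim exE conjE) rule
      \<comment> \<open>The cycle uses up both edges at \<open>u\<close> and at \<open>v\<close>.
        The loss of these two vertices pays for the additional cycle.\<close>
      have "w \<notin> \<Union>(E - ?C)" if "w \<in> {u, v}" for w
      proof -
        have "edeg E w = 2" "w \<in> set vs" using that deg2[OF uv(2,4)] deg2[OF uv(3,5)] vs(3,4) by auto
        then have "edeg (E - ?C) w = 0" using deg[of w] degC[of w] by simp
        then show ?thesis using edeg_pos_iff[of "E - ?C" w] fin by simp
      qed
      then have "u \<notin> \<Union>(E - ?C)" "v \<notin> \<Union>(E - ?C)" by simp_all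
      then have "\<Union>(E - ?C) \<subseteq> \<Union>E - {u, v}" by blast
      then have "card (\<Union>(E - ?C)) \<le> card (\<Union>E - {u, v})" using finU by (intro card_mono) auto
      also have "\<dots> = card (\<Union>E) - 2" using uv(1-3) by (subst card_Diff_subset) auto
      finally have "card (\<Union>(E - ?C)) \<le> card (\<Union>E) - 2" .
      moreover have "card ({?C} \<union> D) \<le> Suc (card D)" using D(1) by (simp add: card_insert_if)
      ultimately have "2 * card ({?C} \<union> D) + 1 \<le> card (\<Union>E)" using D(5) by linarith
      moreover have "?C \<union> (E - ?C) = E" using vs(5) by blast
      moreover have "finite {?C}" "\<forall>C\<in>{?C}. is_cycle C" "pairwise disjnt {?C}" "\<Union>{?C} = ?C"
        using cyc by simp_all
      note Union_cycle_families[OF this D(1-4) Diff_disjoint]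
      ultimately show ?thesis by (intro exI[of _ "{?C} \<union> D"]) (intro conjI; simp only:)
    qed
  qed
qed

section \<open>Vertices of low degree in k-trees\<close>

lemma graph_iso_complete_graph:
  assumes "graph_iso G (complete_graph k)"
  shows "finite (vertices G)" "card (vertices G) = k"
    "\<And>x y. x \<in> vertices G \<Longrightarrow> y \<in> vertices G \<Longrightarrow> x \<noteq> y \<Longrightarrow> {x, y} \<in> edges G"
proof -
  obtain f where f: "bij_betw f (vertices G) {..<k}"
    and E: "\<forall>u\<in>vertices G. \<forall>v\<in>vertices G. {u, v} \<in> edges G \<longleftrightarrow> {f u, f v} \<in> edges (complete_graph k)"
    using assms by (auto simp: graph_iso_def complete_graph_def)
  show "finite (vertices G)" using f bij_betw_finite by blast
  show "card (vertices G) = k" using bij_betw_same_card[OF f] by simp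
  show "{x, y} \<in> edges G" if "x \<in> vertices G" "y \<in> vertices G" "x \<noteq> y" for x y
  proof -
    have "f x < k" "f y < k" "f x \<noteq> f y"
      using that f by (auto simp: bij_betw_def inj_on_def)
    then show ?thesis using that E by (auto simp: complete_graph_def)
  qed
qed

lemma edeg_le_card:
  assumes "finite W" "card W \<le> Suc k" "\<And>e. e \<in> F \<Longrightarrow> card e = 2" "\<Union>F \<subseteq> W"
  shows "edeg F w \<le> k"
proof (cases "w \<in> W")
  case True
  have "{e \<in> F. w \<in> e} \<subseteq> (\<lambda>x. {w, x}) ` (W - {w})"
  proof
    fix e assume e: "e \<in> {e \<in> F. w \<in> e}"
    then obtain x where "e = {w, x}" "x \<noteq> w" using assms(3)[of e] by (auto simp: card_2_iff)
    then show "e \<in> (\<lambda>x. {w, x}) ` (W - {w})" using e assms(4) by auto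
  qed
  then have "edeg F w \<le> card (W - {w})"
    unfolding edeg_def using assms(1) by (meson finite_Diff surj_card_le)
  then show ?thesis using True assms(1,2) by simp
next
  case False
  then show ?thesis using assms(4) by (subst edeg_eq_0) auto
qed

text \<open>
  Avoiding a whole clique \<open>K\<close> makes the induction work: when the last vertex lies in \<open>K\<close>, the
  induction hypothesis is applied to its neighbourhood. The cases \<open>K = {}\<close> and \<open>K = {u}\<close> then
  yield two vertices.
\<close>

lemma ktree_low_degree:
  assumes "ktree k T" "F \<subseteq> edges T"
    and "K \<subseteq> vertices T" "\<And>x y. x \<in> K \<Longrightarrow> y \<in> K \<Longrightarrow> x \<noteq> y \<Longrightarrow> {x, y} \<in> edges T"
  shows "\<Union>F \<subseteq> K \<or> (\<exists>w\<in>\<Union>F - K. edeg F w \<le> k)"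
  using assms
proof (induction arbitrary: F K rule: ktree.induct)
  case (base G)
  have "edeg F w \<le> k" for w
    using base graph_iso_complete_graph(1,2)[OF base(2)]
    by (intro edeg_le_card[of "vertices G"]) (auto simp: simple_graph_def)
  then show ?case by blast
next
  case (step G v)
  let ?N = "neighborhood G v"
  have G: "e \<subseteq> vertices G" "card e = 2" if "e \<in> edges G" for e
    using that step(1) by (auto simp: simple_graph_def)
  have vN: "v \<notin> ?N" using G(2) by (fastforce simp: neighborhood_def)
  have NV: "?N \<subseteq> vertices G" by (auto simp: neighborhood_def)
  then have VI: "vertices (induced_subgraph G ?N) = ?N" by (auto simp: induced_subgraph_def)
  have N: "finite ?N" "card ?N = k" "\<And>x y. x \<in> ?N \<Longrightarrow> y \<in> ?N \<Longrightarrow> x \<noteq> y \<Longrightarrow> {x, y} \<in> edges G"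
    using graph_iso_complete_graph[OF step(3)] unfolding VI by (auto simp: induced_subgraph_def)
  have VD: "vertices (delete_vertex G v) = vertices G - {v}"
    by (auto simp: delete_vertex_def induced_subgraph_def)
  have ED: "edges (delete_vertex G v) = {e \<in> edges G. v \<notin> e}"
    using G(1) by (auto simp: delete_vertex_def induced_subgraph_def)
  have vF: "x \<in> ?N" if "e \<in> edges G" "v \<in> e" "x \<in> e" "x \<noteq> v" for e x
  proof -
    have "e = {x, v}" using G(2)[OF that(1)] that by (auto simp: card_2_iff)
    then show ?thesis using that G(1) by (auto simp: neighborhood_def)
  qed
  consider "v \<in> \<Union>F" "v \<notin> K" | "v \<notin> \<Union>F" | "v \<in> \<Union>F" "v \<in> K" by blast
  then show ?case
  proof cases
    case 1
    \<comment> \<open>Here \<open>v\<close> itself is the witness. Only the star at \<open>v\<close>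
      is known to stay within \<open>k + 1\<close> vertices, so the degree is counted there.\<close>
    have "\<Union>{e \<in> F. v \<in> e} \<subseteq> insert v ?N" using vF step.prems(1) by blast
    then have "edeg {e \<in> F. v \<in> e} v \<le> k"
      using N(1,2) vN step.prems(1) G(2) by (intro edeg_le_card[of "insert v ?N"]) auto
    then have "edeg F v \<le> k" by (simp add: edeg_def)
    then show ?thesis using 1 by blast
  next
    case 2
    \<comment> \<open>All of \<open>F\<close> lives in the smaller tree. Removing \<open>v\<close>
      from \<open>K\<close> is harmless since no edge of \<open>F\<close> contains
      \<open>v\<close>.\<close>
    have "\<Union>F \<subseteq> K - {v} \<or> (\<exists>w\<in>\<Union>F - (K - {v}). edeg F w \<le> k)"
      using step.prems 2 by (intro step.IH) (auto simp: VD ED)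
    then show ?thesis using 2 by blast
  next
    case 3
    let ?F = "{e \<in> F. v \<notin> e}"
    have KN: "K \<subseteq> insert v ?N" using step.prems 3 by (auto simp: neighborhood_def)
    \<comment> \<open>A witness outside the neighbourhood lies on no edge at \<open>v\<close>, so
      restoring those edges leaves its degree unchanged, and it also lies outside \<open>K\<close>.
      Without such a witness, \<open>F\<close> lives on \<open>k + 1\<close> vertices and every
      degree is at most \<open>k\<close>.\<close>
    have "\<Union>?F \<subseteq> ?N \<or> (\<exists>w\<in>\<Union>?F - ?N. edeg ?F w \<le> k)"
      using step.prems N NV vN by (intro step.IH) (auto simp: VD ED)
    then show ?thesis
    proof
      assume sub: "\<Union>?F \<subseteq> ?N"
      have "\<Union>F \<subseteq> insert v ?N"
      proof
        fix x assume "x \<in> \<Union>F"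
        then obtain e where "e \<in> F" "x \<in> e" by blast
        then show "x \<in> insert v ?N" using sub vF[of e x] step.prems(1) by (cases "v \<in> e") auto
      qed
      then have "edeg F w \<le> k" for w
        using N vN step.prems(1) G by (intro edeg_le_card[of "insert v ?N"]) auto
      then show ?thesis by blast
    next
      assume "\<exists>w\<in>\<Union>?F - ?N. edeg ?F w \<le> k"
      then obtain w where w: "w \<in> \<Union>?F" "w \<notin> ?N" "edeg ?F w \<le> k" by blast
      then have "w \<noteq> v" by blast
      then have "{e \<in> F. w \<in> e} = {e \<in> ?F. w \<in> e}"
        using vF[of _ w] w(2) step.prems(1) by auto
      then have "edeg F w \<le> k" using w(3) by (simp add: edeg_def)
      then show ?thesis using w \<open>w \<noteq> v\<close> KN by blast
    qed
  qed
qed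

lemma ktree_two_sparse:
  assumes "ktree 3 T"
  shows "two_sparse (edges T)"
  unfolding two_sparse_def
proof (intro allI impI, elim conjE)
  fix F assume F: "F \<subseteq> edges T" "F \<noteq> {}"
  have T: "simple_graph T" using assms by (cases rule: ktree.cases) auto
  obtain e where e: "e \<in> F" "card e = 2" "e \<subseteq> vertices T" using F T by (auto simp: simple_graph_def)
  \<comment> \<open>An edge has two endpoints, which excludes the first alternative of
    \<open>ktree_low_degree\<close> for \<open>{}\<close> and for \<open>{u}\<close>.\<close>
  have ne: "\<not> \<Union>F \<subseteq> {x}" for x
  proof
    assume "\<Union>F \<subseteq> {x}"
    then have "e \<subseteq> {x}" using e by blast
    then have "card e \<le> 1" using card_mono[of "{x}" e] by simp
    then show False using e(2) by simp
  qed
  obtain u where u: "u \<in> \<Union>F" "edeg F u \<le> 3"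
    using ktree_low_degree[OF assms F(1), of "{}"] ne by blast
  have "u \<in> vertices T" using u F T by (auto simp: simple_graph_def)
  then obtain v where "v \<in> \<Union>F" "v \<noteq> u" "edeg F v \<le> 3"
    using ktree_low_degree[OF assms F(1), of "{u}"] ne[of u] by blast
  then show "\<exists>u v. u \<noteq> v \<and> u \<in> \<Union>F \<and> v \<in> \<Union>F \<and> edeg F u \<le> 3 \<and> edeg F v \<le> 3" using u by blast
qed

section \<open>Transfer to partial 3-trees and the final bound\<close>

text \<open>An injective vertex map preserves incidence and is injective on edges, so degrees in
  \<open>F\<close> and in its image agree. Asking only for inclusion in \<open>E'\<close> covers
  both steps of a partial k-tree, the isomorphism and the passage to a subgraph.\<close>

lemma two_sparse_vimage:
  assumes "two_sparse E'" "inj_on f (\<Union>E)" "(`) f ` E \<subseteq> E'"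
  shows "two_sparse E"
  unfolding two_sparse_def
proof (intro allI impI, elim conjE)
  fix F assume F: "F \<subseteq> E" "F \<noteq> {}"
  let ?F = "(`) f ` F"
  have "?F \<subseteq> E'" "?F \<noteq> {}" using F assms(3) by auto
  then obtain u' v' where "u' \<noteq> v'" "u' \<in> \<Union>?F" "v' \<in> \<Union>?F" "edeg ?F u' \<le> 3" "edeg ?F v' \<le> 3"
    using assms(1) unfolding two_sparse_def by meson
  then obtain u v where uv: "f u \<noteq> f v" "u \<in> \<Union>F" "v \<in> \<Union>F" "edeg ?F (f u) \<le> 3" "edeg ?F (f v) \<le> 3"
    by blast
  have "edeg ?F (f w) = edeg F w" if "w \<in> \<Union>F" for w
  proof -
    have mem: "f w \<in> f ` e \<longleftrightarrow> w \<in> e" if "e \<in> F" for e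
      using inj_on_image_mem_iff[OF assms(2), of w e] that \<open>w \<in> \<Union>F\<close> F(1) by blast
    have "{e \<in> ?F. f w \<in> e} = (`) f ` {e \<in> F. w \<in> e}" using mem by auto
    moreover have "inj_on ((`) f) {e \<in> F. w \<in> e}"
    proof (rule inj_onI)
      fix d e assume de: "d \<in> {e \<in> F. w \<in> e}" "e \<in> {e \<in> F. w \<in> e}" "f ` d = f ` e"
      then have "d \<subseteq> \<Union>E" "e \<subseteq> \<Union>E" using F(1) by blast+
      then show "d = e" using de(3) inj_on_image_eq_iff[OF assms(2)] by blast
    qed
    ultimately show ?thesis by (simp add: edeg_def card_image)
  qed
  then show "\<exists>u v. u \<noteq> v \<and> u \<in> \<Union>F \<and> v \<in> \<Union>F \<and> edeg F u \<le> 3 \<and> edeg F v \<le> 3"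
    using uv by (metis (full_types))
qed

lemma partial_ktree_two_sparse:
  assumes "simple_graph G" "partial_ktree 3 G"
  shows "two_sparse (edges G)"
proof -
  obtain T :: "nat ugraph" and H where T: "ktree 3 T" "subgraph H T" "graph_iso G H"
    using assms(2) by (auto simp: partial_ktree_def)
  obtain f where f: "bij_betw f (vertices G) (vertices H)"
    and fE: "\<forall>u\<in>vertices G. \<forall>v\<in>vertices G. {u, v} \<in> edges G \<longleftrightarrow> {f u, f v} \<in> edges H"
    using T(3) by (auto simp: graph_iso_def)
  have U: "\<Union>(edges G) \<subseteq> vertices G" using assms(1) by (auto simp: simple_graph_def)
  show ?thesis
  proof (rule two_sparse_vimage[OF ktree_two_sparse[OF T(1)]])
    show "inj_on f (\<Union>(edges G))" using f U by (meson bij_betw_def inj_on_subset)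
    show "(`) f ` edges G \<subseteq> edges T"
    proof (rule image_subsetI)
      fix e assume e: "e \<in> edges G"
      then obtain x y where "e = {x, y}" using assms(1) by (auto simp: simple_graph_def card_2_iff)
      moreover from this have "x \<in> vertices G" "y \<in> vertices G" using e U by blast+
      ultimately have "f ` e \<in> edges H" using e fE by auto
      then show "f ` e \<in> edges T" using T(2) by (auto simp: subgraph_def)
    qed
  qed
qed

theorem theorem3p5:
  fixes G :: "'a ugraph" and n :: nat
  assumes "simple_graph G"
    and "connected_graph G"
    and "eulerian G"
    and "partial_ktree 3 G"
    and "card (vertices G) = n"
  shows "cn G \<le> (n - 1) div 2"
proof -
  have E: "finite (vertices G)" "\<And>e. e \<in> edges G \<Longrightarrow> e \<subseteq> vertices G" "\<And>e. e \<in> edges G \<Longrightarrow> card e = 2"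
    using assms(1) by (auto simp: simple_graph_def)
  have fin: "finite (edges G)" using E(1,2) by (meson Sup_le_iff finite_UnionD finite_subset)
  have "\<exists>D. cycle_decomposition G D \<and> card D \<le> (n - 1) div 2"
  \<comment> \<open>Without edges the empty family is a decomposition;
    \<open>cycle_decomposition_bound\<close> requires at least one edge.\<close>
  proof (cases "edges G = {}")
    case True
    then show ?thesis by (intro exI[of _ "{}"]) (auto simp: cycle_decomposition_def)
  next
    case False
    have "even (edeg (edges G) v)" for v
    proof (cases "v \<in> vertices G")
      case True
      then show ?thesis using assms(3) by (simp add: eulerian_def degree_def edeg_def)
    next
      case False
      then show ?thesis using E(2) by (subst edeg_eq_0) auto
    qed
    then obtain D where D: "\<forall>C\<in>D. is_cycle C" "pairwise disjnt D" "\<Union>D = edges G"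
      "2 * card D + 1 \<le> card (\<Union>(edges G))"
      using cycle_decomposition_bound[OF fin E(3) _ partial_ktree_two_sparse[OF assms(1,4)] False]
      by blast
    have "card (\<Union>(edges G)) \<le> n" unfolding assms(5)[symmetric] using E by (intro card_mono) auto
    then show ?thesis using D by (intro exI[of _ D]) (auto simp: cycle_decomposition_def)
  qed
  then obtain D where D: "cycle_decomposition G D" "card D \<le> (n - 1) div 2" by blast
  have "cn G \<le> card D" unfolding cn_def using D(1) by (intro Least_le) blast
  then show ?thesis using D(2) by linarith
qed

end
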